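(* Let $n\ge 1$ and consider the discrete-time system $x_{k+1}=A_kx_k+b_ku_k$, $y_k=c_kx_k$ ($k\in\mathbb{Z}$), where each $A_k$ is a real $n\times n$ matrix, $b_k\in\mathbb{R}^{n\times 1}$ and $c_k\in\mathbb{R}^{1\times n}$. Suppose the system is completely controllable, completely observable, and $c_k\,\operatorname{adj}(A_k)\,b_k\neq 0$ for every $k\in\mathbb{Z}$. Then the system is uniformly nullifiable by memoryless linear output feedback.
   Context: Complete controllability: for every $k\in\mathbb{Z}$ and every $\xi_s,\xi_f\in\mathbb{R}^n$ there are controls $u_k,\dots,u_{k+n-1}$ such that $x_k=\xi_s$ implies $x_{k+n}=\xi_f$. Complete observability: for every $k\in\mathbb{Z}$ and all controls $u_k,\dots,u_{k+n-2}$, the state $x_k$ is uniquely determined by the outputs $y_k,\dots,y_{k+n-1}$. $\operatorname{adj}(A)$ denotes the adjugate of $A$ (the matrix whose $(j,i)$ entry is $(-1)^{i+j}$ times the minor of $A$ obtained by deleting row $i$ and column $j$), so $A\operatorname{adj}(A)=\det(A)I$. Uniform nullifiability by memoryless linear output feedback: there exist scalars $\{F_k\}_{k\in\mathbb{Z}}$ and $N\in\mathbb{N}$ such that for every $k\in\mathbb{Z}$ and every $x_k\in\mathbb{R}^n$, the sequence generated by the closed-loop dynamics $x_{j+1}=(A_j+F_jb_jc_j)x_j$ (i.e. the feedback $u_j=F_jy_j$) satisfies $x_{k+N}=0$. *)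

theory Defs
  imports "Jordan_Normal_Form.Determinant"
begin

text \<open>System x_(k+1) = A_k x_k + b_k u_k, y_k = c_k x_k with A_k n x n, b_k n x 1, c_k 1 x n.
  Scalar controls u_j are fed in as the 1-vector vec 1 (\<lambda>_. u j).\<close>

fun traj :: "(int \<Rightarrow> real mat) \<Rightarrow> (int \<Rightarrow> real mat) \<Rightarrow> int \<Rightarrow> real vec \<Rightarrow> (int \<Rightarrow> real)
    \<Rightarrow> nat \<Rightarrow> real vec" where
  "traj A b k x u 0 = x"
| "traj A b k x u (Suc m) =
     A (k + int m) *\<^sub>v traj A b k x u m + b (k + int m) *\<^sub>v vec 1 (\<lambda>_. u (k + int m))"

definition sys_output :: "(int \<Rightarrow> real mat) \<Rightarrow> (int \<Rightarrow> real mat) \<Rightarrow> (int \<Rightarrow> real mat)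
    \<Rightarrow> int \<Rightarrow> real vec \<Rightarrow> (int \<Rightarrow> real) \<Rightarrow> nat \<Rightarrow> real" where
  "sys_output A b c k x u j = (c (k + int j) *\<^sub>v traj A b k x u j) $ 0"

definition completely_controllable :: "nat \<Rightarrow> (int \<Rightarrow> real mat) \<Rightarrow> (int \<Rightarrow> real mat) \<Rightarrow> bool" where
  "completely_controllable n A b \<longleftrightarrow>
     (\<forall>k. \<forall>\<xi>s \<in> carrier_vec n. \<forall>\<xi>f \<in> carrier_vec n. \<exists>u. traj A b k \<xi>s u n = \<xi>f)"

definition completely_observable :: "nat \<Rightarrow> (int \<Rightarrow> real mat) \<Rightarrow> (int \<Rightarrow> real mat)
    \<Rightarrow> (int \<Rightarrow> real mat) \<Rightarrow> bool" where
  "completely_observable n A b c \<longleftrightarrow>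
     (\<forall>k u. \<forall>x \<in> carrier_vec n. \<forall>x' \<in> carrier_vec n.
        (\<forall>j<n. sys_output A b c k x u j = sys_output A b c k x' u j) \<longrightarrow> x = x')"

fun closed_loop :: "(int \<Rightarrow> real mat) \<Rightarrow> (int \<Rightarrow> real mat) \<Rightarrow> (int \<Rightarrow> real mat) \<Rightarrow> (int \<Rightarrow> real)
    \<Rightarrow> int \<Rightarrow> real vec \<Rightarrow> nat \<Rightarrow> real vec" where
  "closed_loop A b c F k x 0 = x"
| "closed_loop A b c F k x (Suc m) =
     (A (k + int m) + F (k + int m) \<cdot>\<^sub>m (b (k + int m) * c (k + int m))) *\<^sub>v closed_loop A b c F k x m"

definition uniformly_nullifiable :: "nat \<Rightarrow> (int \<Rightarrow> real mat) \<Rightarrow> (int \<Rightarrow> real mat)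
    \<Rightarrow> (int \<Rightarrow> real mat) \<Rightarrow> bool" where
  "uniformly_nullifiable n A b c \<longleftrightarrow>
     (\<exists>F :: int \<Rightarrow> real. \<exists>N :: nat. \<forall>k. \<forall>x \<in> carrier_vec n. closed_loop A b c F k x N = 0\<^sub>v n)"

end

theory Submission
  imports Defs "HOL-Library.Function_Algebras"
begin

text \<open>A preliminary output feedback makes every \<open>A\<^sub>k\<close> invertible: the condition
  \<open>c\<^sub>k adj(A\<^sub>k) b\<^sub>k \<noteq> 0\<close> then reads \<open>c\<^sub>k A\<^sub>k\<^sup>-\<^sup>1 b\<^sub>k \<noteq> 0\<close>. In moving coordinates
  the closed loop becomes \<open>z \<mapsto> z + F\<^sub>j (c\<^sub>j z) b\<^sub>j\<close> with \<open>c\<^sub>j b\<^sub>j \<noteq> 0\<close>, and any \<open>n\<close> consecutive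
  \<open>b\<^sub>j\<close> (resp. \<open>c\<^sub>j\<close>) form a basis of the state space (resp. of its dual).

  Fix an initial state \<open>z\<close> and let \<open>R\<^sub>j\<close> be the span of the states reachable from it at time \<open>j\<close>.
  These spaces increase, so among \<open>n\<close> successive windows of length \<open>n\<close> there is one on which
  \<open>R\<^sub>j = R\<close> is constant. At each time of that window either \<open>c\<^sub>j\<close> vanishes on \<open>R\<close> or
  \<open>b\<^sub>j \<in> R\<close>, and counting dimensions shows that the \<open>b\<^sub>j\<close> of the second kind form a basis of \<open>R\<close>.
  Removing the components along this basis one after another steers a state of \<open>R\<close> to \<open>0\<close>,
  provided certain functionals, nonzero on \<open>R\<close> because \<open>c\<^sub>j b\<^sub>j \<noteq> 0\<close>, do not vanish at it; generic
  earlier feedback achieves this. Hence every single state can be nullified in \<open>n\<^sup>2\<close> steps, and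
  treating the images of the basis vectors one by one nullifies the whole space.\<close>

section \<open>Rank-one updates of the identity\<close>

definition unit_fun :: "'i \<Rightarrow> 'i \<Rightarrow> real" where
  "unit_fun i = (\<lambda>j. if j = i then 1 else 0)"

interpretation fun_vs: vector_space "\<lambda>a (f :: 'i \<Rightarrow> real) i. a * f i"
  by unfold_locales (auto simp: fun_eq_iff algebra_simps)

lemma sum_fun_apply: "(\<Sum>a\<in>A. f a) x = (\<Sum>a\<in>A. f a x)" for f :: "'a \<Rightarrow> 'i \<Rightarrow> real"
  by (induction A rule: infinite_finite_induct) auto

lemma in_span_unit_fun:
  fixes f :: "'i \<Rightarrow> real"
  assumes "finite J" "\<And>i. i \<notin> J \<Longrightarrow> f i = 0"
  shows "f \<in> fun_vs.span (unit_fun ` J)"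
proof -
  have "f = (\<Sum>i\<in>J. (\<lambda>j. f i * unit_fun i j))"
    using assms by (auto simp: fun_eq_iff sum_fun_apply unit_fun_def if_distrib cong: if_cong)
  moreover have "\<dots> \<in> fun_vs.span (unit_fun ` J)"
    by (intro fun_vs.span_sum fun_vs.span_scale fun_vs.span_base) auto
  ultimately show ?thesis by simp
qed

lemma inj_unit_fun: "inj unit_fun"
  by (rule injI) (metis unit_fun_def zero_neq_one)

lemma independent_unit_fun:
  assumes "finite J"
  shows "\<not> fun_vs.dependent (unit_fun ` J)"
proof (rule fun_vs.independent_if_scalars_zero)
  fix g :: "('a \<Rightarrow> real) \<Rightarrow> real" and x
  assume g: "(\<Sum>x\<in>unit_fun ` J. (\<lambda>i. g x * x i)) = 0" and "x \<in> unit_fun ` J"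
  then obtain j where j: "j \<in> J" "x = unit_fun j" by auto
  have "0 = (\<Sum>i\<in>J. g (unit_fun i) * unit_fun i j)"
    using fun_cong[OF g, of j]
    by (simp add: sum_fun_apply sum.reindex[OF inj_on_subset[OF inj_unit_fun subset_UNIV]])
  also have "\<dots> = g x"
    using j assms by (simp add: unit_fun_def if_distrib cong: if_cong)
  finally show "g x = 0" by simp
qed (use assms in simp)

context vector_space
begin

text \<open>Exchange bound: a redundant element of \<open>S\<close> could be deleted, leaving too
  few vectors to span \<open>T\<close>.\<close>

lemma independent_of_card_le_spanning:
  assumes "finite S" "finite T" "card S \<le> card T" "independent T" "T \<subseteq> span S"
  shows "card S = card T" "independent S"
proof -
  show "card S = card T"
    using independent_span_bound[of S T] assms by simp
  show "independent S"
  proof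
    assume "dependent S"
    then obtain a where a: "a \<in> S" "a \<in> span (S - {a})" unfolding dependent_def by blast
    then have "span (S - {a}) = span S"
      using span_redundant[of a "S - {a}"] by (simp add: insert_absorb)
    then have "card T \<le> card (S - {a})"
      using independent_span_bound[of "S - {a}" T] assms by simp
    moreover have "card (S - {a}) < card S"
      using a assms(1) by (intro psubset_card_mono) auto
    ultimately show False using assms by simp
  qed
qed

end

locale vector_space_real = vector_space scale
  for scale :: "real \<Rightarrow> 'v :: ab_group_add \<Rightarrow> 'v" (infixr "*s" 75)
begin

definition functional :: "('v \<Rightarrow> real) \<Rightarrow> bool" where
  "functional p \<longleftrightarrow> (\<forall>x y. p (x + y) = p x + p y) \<and> (\<forall>a x. p (a *s x) = a * p x)"

lemma functional_add: "functional p \<Longrightarrow> p (x + y) = p x + p y"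
  by (simp add: functional_def)

lemma functional_scale: "functional p \<Longrightarrow> p (a *s x) = a * p x"
  by (simp add: functional_def)

lemma functional_zero: "functional p \<Longrightarrow> p 0 = 0"
  using functional_scale[of p 0 0] by simp

lemma functional_sum: "functional p \<Longrightarrow> p (\<Sum>i\<in>I. f i) = (\<Sum>i\<in>I. p (f i))"
  by (induction I rule: infinite_finite_induct) (auto simp: functional_zero functional_add)

lemma functional_diff: "functional p \<Longrightarrow> p (x - y) = p x - p y"
  using functional_add[of p "x - y" y] by simp

lemma functional_span_eq_0:
  assumes "functional p" "\<And>v. v \<in> S \<Longrightarrow> p v = 0" "w \<in> span S"
  shows "p w = 0"
  using assms(3,2)
  by (induction rule: span_induct_alt)
     (auto simp: functional_zero[OF assms(1)] functional_add[OF assms(1)] functional_scale[OF assms(1)])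

end

text \<open>The system in moving coordinates, with identity drift. \<open>b_spans\<close> and
  \<open>c_separates\<close> encode controllability and observability on each window of length
  \<open>n\<close>, \<open>c_b\<close> the adjugate condition; the state space is
  \<open>span E\<close>, possibly smaller than the type.\<close>

locale rank_one_system = vector_space_real scale
  for scale :: "real \<Rightarrow> 'v :: ab_group_add \<Rightarrow> 'v" (infixr "*s" 75) +
  fixes n :: nat and E :: "'v set" and b :: "nat \<Rightarrow> 'v" and c :: "nat \<Rightarrow> 'v \<Rightarrow> real"
  assumes E: "finite E" "card E = n" "independent E"
    and b_in: "b j \<in> span E"
    and c_functional: "functional (c j)"
    and b_spans: "E \<subseteq> span (b ` {s..<s+n})"
    and c_separates: "z \<in> span E \<Longrightarrow> (\<And>i. i \<in> {s..<s+n} \<Longrightarrow> c i z = 0) \<Longrightarrow> z = 0"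
    and c_b: "c j (b j) \<noteq> 0"
begin

section \<open>Orbits, reachable directions and generic feedback\<close>

fun orbit :: "(nat \<Rightarrow> real) \<Rightarrow> 'v \<Rightarrow> nat \<Rightarrow> 'v" where
  "orbit F z 0 = z"
| "orbit F z (Suc j) = orbit F z j + (F j * c j (orbit F z j)) *s b j"

text \<open>\<open>dirs z j\<close> is a basis of the span of the states reachable from \<open>z\<close> by output feedback
  in \<open>j\<close> steps.\<close>

fun dirs :: "'v \<Rightarrow> nat \<Rightarrow> 'v set" where
  "dirs z 0 = {z}"
| "dirs z (Suc j) = (if (\<forall>v\<in>dirs z j. c j v = 0) \<or> b j \<in> span (dirs z j)
     then dirs z j else insert (b j) (dirs z j))"

lemma orbit_cong: "(\<And>i. i < j \<Longrightarrow> F i = G i) \<Longrightarrow> orbit F z j = orbit G z j"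
  by (induction j) auto

lemma orbit_zero: "orbit F z s = 0 \<Longrightarrow> orbit F z (s + m) = 0"
  by (induction m) (auto simp: functional_zero[OF c_functional])

lemma dirs_mono: "i \<le> j \<Longrightarrow> dirs z i \<subseteq> dirs z j"
  by (induction j rule: dec_induct) auto

lemma finite_dirs: "finite (dirs z j)"
  by (induction j) auto

lemma dirs_subset: "z \<in> span E \<Longrightarrow> dirs z j \<subseteq> span E"
  by (induction j) (auto simp: b_in)

lemma independent_dirs: "z \<noteq> 0 \<Longrightarrow> independent (dirs z j)"
  by (induction j) (simp_all add: independent_insertI)

lemma card_dirs_le: "z \<noteq> 0 \<Longrightarrow> z \<in> span E \<Longrightarrow> card (dirs z j) \<le> n"
  using independent_span_bound[OF E(1) independent_dirs dirs_subset] E(2) by auto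

lemma b_in_span_dirs:
  assumes "v \<in> dirs z j" "c j v \<noteq> 0"
  shows "b j \<in> span (dirs z (Suc j))"
  using assms by (auto intro: span_base)

lemma orbit_in_span_dirs: "orbit F z j \<in> span (dirs z j)"
proof (induction j)
  case (Suc j)
  have up: "orbit F z j \<in> span (dirs z (Suc j))"
    using Suc span_mono[OF dirs_mono[of j "Suc j" z]] by (auto simp del: dirs.simps)
  show ?case
  proof (cases "\<forall>v\<in>dirs z j. c j v = 0")
    case True
    then have "c j (orbit F z j) = 0"
      using functional_span_eq_0[OF c_functional _ Suc] by blast
    then show ?thesis using up by simp
  next
    case False
    then have "b j \<in> span (dirs z (Suc j))" using b_in_span_dirs by blast
    then show ?thesis using up by (auto simp del: dirs.simps intro: span_add span_scale)
  qed
qed (auto intro: span_base)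

text \<open>Induction on time. A new direction enters only through a nonzero output, which the
  induction hypothesis supplies along with the other conditions; each condition then rules out at
  most one gain.\<close>

lemma orbit_generic:
  assumes "finite P" "\<And>p. p \<in> P \<Longrightarrow> functional p \<and> (\<exists>v\<in>dirs z j. p v \<noteq> 0)"
  shows "\<exists>F. \<forall>p\<in>P. p (orbit F z j) \<noteq> 0"
  using assms
proof (induction j arbitrary: P)
  case (Suc j)
  show ?case
  proof (cases "dirs z (Suc j) = dirs z j")
    case True
    then obtain F where F: "\<forall>p\<in>P. p (orbit F z j) \<noteq> 0" using Suc by metis
    have "orbit (F(j := 0)) z j = orbit F z j" by (rule orbit_cong) auto
    then have "\<forall>p\<in>P. p (orbit (F(j := 0)) z (Suc j)) \<noteq> 0" using F by simp
    then show ?thesis by blast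
  next
    case False
    then have ins: "dirs z (Suc j) = insert (b j) (dirs z j)" and cj: "\<exists>v\<in>dirs z j. c j v \<noteq> 0"
      by (auto split: if_splits)
    \<comment> \<open>Including \<open>c j\<close> makes the gain at time \<open>j\<close>
      effective. A functional left out vanishes on \<open>dirs z j\<close>, hence is nonzero at
      \<open>b j\<close>.\<close>
    let ?P = "insert (c j) {p\<in>P. \<exists>v\<in>dirs z j. p v \<noteq> 0}"
    have "\<exists>F. \<forall>p\<in>?P. p (orbit F z j) \<noteq> 0"
      by (rule Suc.IH) (use Suc.prems cj c_functional in auto)
    then obtain F where F: "\<forall>p\<in>?P. p (orbit F z j) \<noteq> 0" by blast
    let ?x = "orbit F z j"
    \<comment> \<open>If \<open>p (b j) \<noteq> 0\<close>, this is the only gain at which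
      \<open>p\<close> vanishes; otherwise the quotient is 0 by convention, which merely excludes
      gain 0.\<close>
    let ?bad = "(\<lambda>p. - p ?x / (c j ?x * p (b j))) ` P"
    have "finite ?bad" using Suc.prems by simp
    then obtain f where f: "f \<notin> ?bad" using ex_new_if_finite[OF infinite_UNIV_char_0] by blast
    have x: "orbit (F(j := f)) z j = ?x" by (rule orbit_cong) auto
    have "p (orbit (F(j := f)) z (Suc j)) \<noteq> 0" if p: "p \<in> P" for p
    proof -
      have fp: "functional p" using Suc.prems p by blast
      have eq: "p (orbit (F(j := f)) z (Suc j)) = p ?x + f * c j ?x * p (b j)"
        by (simp add: x functional_add[OF fp] functional_scale[OF fp])
      show ?thesis
      proof (cases "p (b j) = 0")
        case True
        then have "p \<in> ?P" using Suc.prems(2)[OF p] p unfolding ins by auto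
        then show ?thesis using F eq True by auto
      next
        case pb: False
        have "c j ?x \<noteq> 0" using F by auto
        moreover have "f \<noteq> - p ?x / (c j ?x * p (b j))" using f p by blast
        ultimately show ?thesis unfolding eq using pb by (auto simp: field_simps)
      qed
    qed
    then show ?thesis by blast
  qed
qed auto

text \<open>Strict growth on each of the \<open>n\<close> windows would turn the single vector
  \<open>z\<close> into \<open>n + 1\<close> independent vectors in dimension
  \<open>n\<close>.\<close>

lemma dirs_stagnate:
  assumes "z \<noteq> 0" "z \<in> span E"
  shows "\<exists>i<n. dirs z (i * n + n) = dirs z (i * n)"
proof (rule ccontr)
  assume neg: "\<not> ?thesis"
  have "i \<le> n \<Longrightarrow> card (dirs z (i * n)) \<ge> i + 1" for i
  proof (induction i)
    case (Suc i)
    have "dirs z (i * n) \<subset> dirs z (Suc i * n)"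
      using neg Suc.prems dirs_mono[of "i * n" "Suc i * n" z]
      by (simp add: psubset_eq add.commute) (metis Suc_le_eq)
    then have "card (dirs z (i * n)) < card (dirs z (Suc i * n))"
      by (rule psubset_card_mono[OF finite_dirs])
    then show ?case using Suc by simp
  qed auto
  from this[of n] show False using card_dirs_le[OF assms, of "n * n"] by simp
qed

section \<open>Dimension count and steering on one window\<close>

lemma b_window: "inj_on b {s..<s+n}" "independent (b ` {s..<s+n})"
proof -
  have *: "card (b ` {s..<s+n}) \<le> n" using card_image_le[of "{s..<s+n}" b] by simp
  show "independent (b ` {s..<s+n})"
    using independent_of_card_le_spanning(2)[of "b ` {s..<s+n}" E] * E b_spans by simp
  have "card (b ` {s..<s+n}) = card {s..<s+n}"
    using independent_of_card_le_spanning(1)[of "b ` {s..<s+n}" E] * E b_spans by simp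
  then show "inj_on b {s..<s+n}" by (simp add: eq_card_imp_inj_on)
qed

text \<open>The outputs at the times in \<open>J\<close> embed the span of \<open>B\<close> into a space of dimension \<open>card J\<close>,
  while \<open>b ` J\<close> consists of \<open>card J\<close> independent vectors of it.\<close>

lemma subset_span_b:
  assumes B: "B \<subseteq> span E"
    and J: "J = {i\<in>{s..<s+n}. \<exists>v\<in>B. c i v \<noteq> 0}"
    and bJ: "\<And>i. i \<in> J \<Longrightarrow> b i \<in> span B"
  shows "B \<subseteq> span (b ` J)"
proof
  fix r assume r: "r \<in> B"
  show "r \<in> span (b ` J)"
  proof (rule ccontr)
    assume nr: "r \<notin> span (b ` J)"
    have JW: "J \<subseteq> {s..<s+n}" and finJ: "finite J" by (auto simp: J)
    let ?S = "insert r (b ` J)"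
    have "independent (b ` J)" by (rule independent_mono[OF b_window(2)]) (use JW in blast)
    then have indS: "independent ?S" using nr by (rule independent_insertI[rotated])
    have "card (b ` J) = card J" by (rule card_image) (rule inj_on_subset[OF b_window(1) JW])
    moreover have "r \<notin> b ` J" using nr span_base by blast
    ultimately have cardS: "card ?S = Suc (card J)" using finJ by simp
    define T where "T w = (\<lambda>i. if i \<in> J then c i w else 0)" for w
    interpret pair: vector_space_pair scale "\<lambda>a (f :: nat \<Rightarrow> real) i. a * f i" by unfold_locales
    have T: "Vector_Spaces.linear scale (\<lambda>a f i. a * f i) T"
      by unfold_locales
         (auto simp: T_def fun_eq_iff functional_add[OF c_functional] functional_scale[OF c_functional])
    have SB: "span ?S \<subseteq> span B"
      by (rule span_minimal) (use r bJ in \<open>auto intro: span_base\<close>)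
    have BE: "span B \<subseteq> span E"
      by (rule span_minimal[OF B]) simp
    have inj: "inj_on T (span ?S)"
    proof (rule inj_onI)
      fix x y assume xy: "x \<in> span ?S" "y \<in> span ?S" and eq: "T x = T y"
      then have d: "x - y \<in> span B" using SB by (auto intro: span_diff)
      have "x - y = 0"
      proof (rule c_separates)
        show "x - y \<in> span E" using d BE by blast
        fix i assume i: "i \<in> {s..<s+n}"
        show "c i (x - y) = 0"
        \<comment> \<open>At times outside \<open>J\<close> the output vanishes on all of
          \<open>B\<close>, so equality of \<open>T x\<close> and \<open>T y\<close> covers the
          whole window.\<close>
        proof (cases "i \<in> J")
          case True
          then show ?thesis using fun_cong[OF eq, of i]
            by (simp add: T_def functional_diff[OF c_functional])
        next
          case False
          then show ?thesis using functional_span_eq_0[OF c_functional _ d] i by (auto simp: J)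
        qed
      qed
      then show "x = y" by simp
    qed
    have "\<not> fun_vs.dependent (T ` ?S)"
      by (rule pair.linear_independent_injective_image[OF T indS inj])
    moreover have "T ` ?S \<subseteq> fun_vs.span (unit_fun ` J)"
      using in_span_unit_fun[OF finJ] by (auto simp: T_def)
    ultimately have "card (T ` ?S) \<le> card (unit_fun ` J :: (nat \<Rightarrow> real) set)"
      using fun_vs.independent_span_bound finJ by blast
    moreover have "card (T ` ?S) = card ?S"
      by (rule card_image) (rule inj_on_subset[OF inj], rule span_superset)
    moreover have "card (unit_fun ` J :: (nat \<Rightarrow> real) set) \<le> card J" by (rule card_image_le[OF finJ])
    ultimately show False using cardS by simp
  qed
qed

text \<open>The feedback removes the \<open>b i\<close>-component at each time \<open>i \<in> J\<close>, which is possible as long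
  as the output at that time is nonzero.\<close>

lemma deadbeat:
  assumes "J \<subseteq> {s..<s+n}"
    and z: "orbit G z s = (\<Sum>l\<in>J. \<alpha> l *s b l)"
    and ne: "\<And>i. i \<in> J \<Longrightarrow> c i (\<Sum>l\<in>{l\<in>J. i \<le> l}. \<alpha> l *s b l) \<noteq> 0"
  shows "\<exists>F. orbit F z (s + n) = 0"
proof -
  have finJ: "finite J" using assms(1) finite_subset by blast
  \<comment> \<open>\<open>w i\<close> is the state expected at time \<open>i\<close>, with the
    components of smaller index already removed. The gain chosen next makes the update at time
    \<open>i\<close> equal to \<open>- \<alpha> i *s b i\<close>.\<close>
  define w where "w i = (\<Sum>l\<in>{l\<in>J. i \<le> l}. \<alpha> l *s b l)" for i
  define F where "F i = (if i < s then G i else if i \<in> J then - \<alpha> i / c i (w i) else 0)" for i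
  have "orbit F z (s + m) = w (s + m)" for m
  proof (induction m)
    case 0
    have "orbit F z s = orbit G z s" by (rule orbit_cong) (simp add: F_def)
    moreover have "{l\<in>J. s \<le> l} = J" using assms(1) by auto
    ultimately show ?case using z by (simp add: w_def)
  next
    case (Suc m)
    let ?i = "s + m"
    show ?case
    proof (cases "?i \<in> J")
      case True
      have "{l\<in>J. ?i \<le> l} = insert ?i {l\<in>J. Suc ?i \<le> l}" using True by auto
      then have "w ?i = \<alpha> ?i *s b ?i + w (Suc ?i)" unfolding w_def using finJ by simp
      moreover have "F ?i * c ?i (w ?i) = - \<alpha> ?i"
        using ne[OF True] True by (simp add: F_def w_def)
      ultimately show ?thesis using Suc by simp
    next
      case False
      then have "{l\<in>J. ?i \<le> l} = {l\<in>J. Suc ?i \<le> l}" by (auto simp: Suc_le_eq le_less)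
      then show ?thesis using Suc False by (simp add: F_def w_def)
    qed
  qed
  moreover have "{l\<in>J. s + n \<le> l} = {}" using assms(1) by auto
  then have "w (s + n) = 0" unfolding w_def by (simp only: sum.empty)
  ultimately have "orbit F z (s + n) = 0" by simp
  then show ?thesis by blast
qed

theorem orbit_nullifiable:
  assumes zE: "z \<in> span E"
  shows "\<exists>F. orbit F z (n * n) = 0"
proof (cases "z = 0")
  case True
  then show ?thesis using orbit_zero[of _ z 0 "n * n"] by auto
next
  case False
  obtain k where k: "k < n" "dirs z (k * n + n) = dirs z (k * n)"
    using dirs_stagnate[OF False zE] by blast
  define s where "s = k * n"
  define B where "B = dirs z s"
  define J where "J = {i\<in>{s..<s+n}. \<exists>v\<in>B. c i v \<noteq> 0}"
  have JW: "J \<subseteq> {s..<s+n}" and finJ: "finite J" by (auto simp: J_def)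
  have const: "dirs z i = B" if "s \<le> i" "i \<le> s + n" for i
    using dirs_mono[OF that(1), of z] dirs_mono[OF that(2), of z] k(2) by (auto simp: B_def s_def)
  have BE: "B \<subseteq> span E" unfolding B_def by (rule dirs_subset[OF zE])
  have bB: "b i \<in> span B" if i: "i \<in> J" for i
  proof -
    have "s \<le> i" "i < s + n" using i by (auto simp: J_def)
    then have "dirs z i = B" "dirs z (Suc i) = B"
      using const[of i] const[of "Suc i"] by (simp_all del: dirs.simps)
    moreover obtain v where "v \<in> B" "c i v \<noteq> 0" using i by (auto simp: J_def)
    ultimately show ?thesis using b_in_span_dirs[of v z i] by (simp del: dirs.simps)
  qed
  have BJ: "B \<subseteq> span (b ` J)" by (rule subset_span_b[OF BE J_def bB])
  have indJ: "independent (b ` J)" by (rule independent_mono[OF b_window(2)[of s]]) (use JW in blast)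
  have injJ: "inj_on b J" by (rule inj_on_subset[OF b_window(1) JW])
  \<comment> \<open>Extending to a basis of the whole type makes the coordinates linear everywhere,
    as \<open>functional\<close> demands.\<close>
  define X where "X = extend_basis (b ` J)"
  have indX: "independent X" and spX: "span X = UNIV"
    unfolding X_def using independent_extend_basis[OF indJ] span_extend_basis[OF indJ] by auto
  define \<alpha> where "\<alpha> l w = representation X w (b l)" for l w
  have \<alpha>_add: "\<alpha> l (x + y) = \<alpha> l x + \<alpha> l y" and \<alpha>_scale: "\<alpha> l (a *s x) = a * \<alpha> l x" for l x y a
    unfolding \<alpha>_def using representation_add[OF indX] representation_scale[OF indX] spX by auto
  \<comment> \<open>\<open>p i\<close> sends the state at time \<open>s\<close> to the output that
    \<open>deadbeat\<close> meets at time \<open>i\<close>.\<close>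
  define p where "p i w = c i (\<Sum>l\<in>{l\<in>J. i \<le> l}. \<alpha> l w *s b l)" for i w
  have fp: "functional (p i)" for i
    unfolding functional_def p_def functional_sum[OF c_functional] functional_scale[OF c_functional]
    by (simp add: \<alpha>_add \<alpha>_scale algebra_simps sum.distrib sum_distrib_left)
  have \<alpha>_b: "\<alpha> l (b i) = (if l = i then 1 else 0)" if "l \<in> J" "i \<in> J" for l i
  proof -
    have "b i \<in> X" unfolding X_def using that extend_basis_superset[OF indJ] by blast
    then show ?thesis
      unfolding \<alpha>_def using representation_basis[OF indX] inj_onD[OF injJ _ that] by auto
  qed
  \<comment> \<open>The other coordinates of \<open>b i\<close> vanish. By \<open>c_b\<close>,
    \<open>p i\<close> is thus nonzero at \<open>b i\<close>, a vector of \<open>span B\<close>, and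
    hence somewhere on \<open>dirs z s\<close>.\<close>
  have "p i (b i) = c i (b i)" if "i \<in> J" for i
  proof -
    have "(\<Sum>l\<in>{l\<in>J. i \<le> l}. \<alpha> l (b i) *s b l) = (\<Sum>l\<in>{l\<in>J. i \<le> l}. if l = i then b l else 0)"
      using that by (intro sum.cong) (auto simp: \<alpha>_b)
    also have "\<dots> = b i" using that finJ by simp
    finally show ?thesis by (simp add: p_def)
  qed
  then have pB: "\<exists>v\<in>dirs z s. p i v \<noteq> 0" if "i \<in> J" for i
    using functional_span_eq_0[OF fp _ bB[OF that], of i] c_b[of i] that unfolding B_def by metis
  have "\<exists>G. \<forall>q\<in>p ` J. q (orbit G z s) \<noteq> 0"
    by (rule orbit_generic) (use finJ fp pB in auto)
  then obtain G where G: "\<forall>i\<in>J. p i (orbit G z s) \<noteq> 0" by auto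
  let ?w = "orbit G z s"
  have wJ: "?w \<in> span (b ` J)"
    using orbit_in_span_dirs[of G z s] span_minimal[OF BJ subspace_span] by (auto simp: B_def)
  have rep: "representation X ?w = representation (b ` J) ?w"
    by (rule representation_extend[OF indX wJ]) (simp add: X_def extend_basis_superset[OF indJ])
  have "?w = (\<Sum>v\<in>b ` J. representation (b ` J) ?w v *s v)"
    using sum_representation_eq[OF indJ wJ] finJ by simp
  also have "\<dots> = (\<Sum>l\<in>J. \<alpha> l ?w *s b l)"
    using sum.reindex[OF injJ] by (simp add: \<alpha>_def rep)
  finally have "\<exists>F. orbit F z (s + n) = 0"
    by (rule deadbeat[OF JW]) (use G in \<open>simp add: p_def\<close>)
  then obtain F where "orbit F z (s + n) = 0" by blast
  moreover obtain d where "n = Suc (k + d)" using less_imp_Suc_add[OF k(1)] by blast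
  then have "n * n = s + n + d * n" by (simp add: s_def algebra_simps)
  ultimately show ?thesis using orbit_zero by metis
qed

end

section \<open>Regularization by output feedback\<close>

lemma mult_mat_zero_vec:
  fixes M :: "real mat"
  assumes "M \<in> carrier_mat m n"
  shows "M *\<^sub>v 0\<^sub>v n = 0\<^sub>v m"
  using assms by (intro eq_vecI) auto

lemma smult_mult_mat_vec:
  fixes M :: "real mat"
  assumes "M \<in> carrier_mat m n" "x \<in> carrier_vec n"
  shows "(a \<cdot>\<^sub>m M) *\<^sub>v x = a \<cdot>\<^sub>v (M *\<^sub>v x)"
  using assms by (intro eq_vecI) auto

lemma mult_unit_vec1:
  fixes B :: "real mat"
  assumes "B \<in> carrier_mat n 1"
  shows "B *\<^sub>v vec 1 (\<lambda>_. u) = u \<cdot>\<^sub>v col B 0"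
  using assms by (intro eq_vecI) (auto simp: scalar_prod_def)

lemma rank_one_mult_vec:
  fixes B C :: "real mat"
  assumes "B \<in> carrier_mat n 1" "C \<in> carrier_mat 1 n" "x \<in> carrier_vec n"
  shows "(B * C) *\<^sub>v x = (C *\<^sub>v x) $ 0 \<cdot>\<^sub>v col B 0"
proof -
  have "(B * C) *\<^sub>v x = B *\<^sub>v (C *\<^sub>v x)" using assms by simp
  also have "C *\<^sub>v x = vec 1 (\<lambda>_. (C *\<^sub>v x) $ 0)" using assms by (intro eq_vecI) auto
  finally show ?thesis using mult_unit_vec1[OF assms(1)] by simp
qed

lemma feedback_mult_vec:
  fixes M B C :: "real mat"
  assumes "M \<in> carrier_mat n n" "B \<in> carrier_mat n 1" "C \<in> carrier_mat 1 n" "x \<in> carrier_vec n"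
  shows "(M + f \<cdot>\<^sub>m (B * C)) *\<^sub>v x = M *\<^sub>v x + (f * (C *\<^sub>v x) $ 0) \<cdot>\<^sub>v col B 0"
proof -
  have "(M + f \<cdot>\<^sub>m (B * C)) *\<^sub>v x = M *\<^sub>v x + f \<cdot>\<^sub>v ((B * C) *\<^sub>v x)"
    using assms by (subst add_mult_distrib_mat_vec) (auto simp: smult_mult_mat_vec[of _ n n])
  then show ?thesis
    using rank_one_mult_vec[OF assms(2-4)] by (simp add: smult_smult_assoc)
qed

text \<open>Replacing row \<open>i\<close> keeps the cofactors along that row, so Laplace expansion
  pairs \<open>C\<close> with column \<open>i\<close> of the adjugate.\<close>

lemma row_mult_adj_mat:
  fixes M :: "real mat"
  assumes M: "M \<in> carrier_mat n n" and C: "C \<in> carrier_mat 1 n" and i: "i < n"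
  shows "(C * adj_mat M) $$ (0, i) =
    det (mat n n (\<lambda>(k, j). if k = i then C $$ (0, j) else M $$ (k, j)))" (is "_ = det ?R")
proof -
  have del: "mat_delete ?R i j = mat_delete M i j" for j
    using M i by (intro eq_matI) (auto simp: mat_delete_def insert_index_def)
  have "det ?R = (\<Sum>j<n. ?R $$ (i, j) * cofactor ?R i j)"
    by (rule laplace_expansion_row) (use i in auto)
  also have "\<dots> = (\<Sum>j<n. C $$ (0, j) * cofactor M i j)"
    using i by (intro sum.cong) (auto simp: cofactor_def del)
  also have "\<dots> = (C * adj_mat M) $$ (0, i)"
    using M C i by (auto simp: adj_mat_def scalar_prod_def atLeast0LessThan intro: sum.cong)
  finally show ?thesis by simp
qed

text \<open>A nonzero \<open>x\<close> killed by \<open>M\<close> and \<open>C\<close> is killed by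
  \<open>M\<close> with any row replaced by \<open>C\<close>. These matrices are then singular, so
  all entries of \<open>C * adj_mat M\<close> vanish.\<close>

lemma output_nonzero_on_kernel:
  fixes M :: "real mat"
  assumes M: "M \<in> carrier_mat n n" and B: "B \<in> carrier_mat n 1" and C: "C \<in> carrier_mat 1 n"
    and adj: "(C * adj_mat M * B) $$ (0, 0) \<noteq> 0"
    and x: "x \<in> carrier_vec n" "M *\<^sub>v x = 0\<^sub>v n" "(C *\<^sub>v x) $ 0 = 0"
  shows "x = 0\<^sub>v n"
proof (rule ccontr)
  assume "x \<noteq> 0\<^sub>v n"
  have "(C * adj_mat M) $$ (0, i) = 0" if i: "i < n" for i
  proof -
    let ?R = "mat n n (\<lambda>(k, j). if k = i then C $$ (0, j) else M $$ (k, j))"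
    have "(?R *\<^sub>v x) $ k = 0" if k: "k < n" for k
    proof (cases "k = i")
      case True
      then have "(?R *\<^sub>v x) $ k = (C *\<^sub>v x) $ 0"
        using i C x(1) by (auto simp: scalar_prod_def intro: sum.cong)
      then show ?thesis using x by simp
    next
      case False
      then have "(?R *\<^sub>v x) $ k = (M *\<^sub>v x) $ k"
        using k M x(1) by (auto simp: scalar_prod_def intro: sum.cong)
      then show ?thesis using x k by simp
    qed
    then have "?R *\<^sub>v x = 0\<^sub>v n" by (intro eq_vecI) auto
    then have "det ?R = 0"
      using det_0_iff_vec_prod_zero[of ?R n] x(1) \<open>x \<noteq> 0\<^sub>v n\<close> by auto
    then show ?thesis using row_mult_adj_mat[OF M C i] by simp
  qed
  moreover have "(X * B) $$ (0, 0) = 0"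
    if "X \<in> carrier_mat 1 n" "\<And>i. i < n \<Longrightarrow> X $$ (0, i) = 0" for X
    using that B by (simp add: scalar_prod_def)
  ultimately have "(C * adj_mat M * B) $$ (0, 0) = 0"
    using mult_carrier_mat[OF C adj_mat(1)[OF M]] by blast
  then show False using adj by simp
qed

text \<open>The adjugate applied to \<open>col B 0\<close> gives a vector \<open>v\<close> with
  nonzero output that \<open>M\<close> maps to a multiple of \<open>col B 0\<close>; it replaces the
  inverse image even when \<open>M\<close> is singular.\<close>

lemma regularizing_feedback:
  fixes M :: "real mat"
  assumes M: "M \<in> carrier_mat n n" and B: "B \<in> carrier_mat n 1" and C: "C \<in> carrier_mat 1 n"
    and adj: "(C * adj_mat M * B) $$ (0, 0) \<noteq> 0"
  shows "\<exists>f V. V \<in> carrier_mat n n \<and> V * (M + f \<cdot>\<^sub>m (B * C)) = 1\<^sub>m n \<and>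
    (M + f \<cdot>\<^sub>m (B * C)) * V = 1\<^sub>m n \<and> (C *\<^sub>v (V *\<^sub>v col B 0)) $ 0 \<noteq> 0"
proof -
  note adjM = adj_mat[OF M]
  define v where "v = adj_mat M *\<^sub>v col B 0"
  have cB: "col B 0 \<in> carrier_vec n" and v: "v \<in> carrier_vec n"
    using B adjM(1) by (auto simp: v_def)
  have C_smult: "(C *\<^sub>v (a \<cdot>\<^sub>v w)) $ 0 = a * (C *\<^sub>v w) $ 0" if "w \<in> carrier_vec n" for a w
    unfolding mult_mat_vec[OF C that] using C by (intro index_smult_vec(1)) simp
  have Cv: "(C *\<^sub>v v) $ 0 \<noteq> 0"
  proof -
    have "(X * B) $$ (0, 0) = (X *\<^sub>v col B 0) $ 0" if "X \<in> carrier_mat 1 n" for X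
      using that B by simp
    then have "(C * adj_mat M * B) $$ (0, 0) = ((C * adj_mat M) *\<^sub>v col B 0) $ 0"
      using C adjM(1) by (metis mult_carrier_mat)
    then show ?thesis using adj assoc_mult_mat_vec[OF C adjM(1) cB] by (simp add: v_def)
  qed
  have Mv: "M *\<^sub>v v = det M \<cdot>\<^sub>v col B 0"
    using assoc_mult_mat_vec[OF M adjM(1) cB] adjM(2) cB
    by (simp add: v_def smult_mult_mat_vec[of _ n n])
  define f :: real where "f = (if det M = 0 then 1 else 0)"
  define M' where "M' = M + f \<cdot>\<^sub>m (B * C)"
  have M': "M' \<in> carrier_mat n n" using M B C by (auto simp: M'_def)
  have M'x: "M' *\<^sub>v x = M *\<^sub>v x + (f * (C *\<^sub>v x) $ 0) \<cdot>\<^sub>v col B 0" if "x \<in> carrier_vec n" for x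
    unfolding M'_def by (rule feedback_mult_vec[OF M B C that])
  have detM': "det M' \<noteq> 0"
  proof (cases "det M = 0")
    case False
    have "f \<cdot>\<^sub>m (B * C) = 0\<^sub>m n n" using False B C by (intro eq_matI) (auto simp: f_def)
    then show ?thesis using False M by (simp add: M'_def)
  next
    case det0: True
    \<comment> \<open>Applying the adjugate to \<open>M' x = 0\<close> cancels \<open>M x\<close>,
      as \<open>det M = 0\<close>, and leaves \<open>?y\<close> times \<open>v\<close>. Since
      \<open>v\<close> has nonzero output, \<open>?y = 0\<close>, so \<open>x\<close> lies in the
      kernels of \<open>M\<close> and \<open>C\<close>.\<close>
    have "x = 0\<^sub>v n" if x: "x \<in> carrier_vec n" "M' *\<^sub>v x = 0\<^sub>v n" for x
    proof -
      let ?y = "(C *\<^sub>v x) $ 0"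
      have Mx: "M *\<^sub>v x + ?y \<cdot>\<^sub>v col B 0 = 0\<^sub>v n" using M'x[OF x(1)] x(2) det0 by (simp add: f_def)
      have "0\<^sub>v n = adj_mat M *\<^sub>v (M *\<^sub>v x + ?y \<cdot>\<^sub>v col B 0)"
        unfolding Mx using adjM(1) by (intro eq_vecI) auto
      also have "\<dots> = adj_mat M *\<^sub>v (M *\<^sub>v x) + ?y \<cdot>\<^sub>v v"
        using adjM(1) M x(1) cB by (simp add: mult_add_distrib_mat_vec[of _ n n] mult_mat_vec[of _ n n] v_def)
      also have "adj_mat M *\<^sub>v (M *\<^sub>v x) = 0\<^sub>v n"
      proof -
        have "adj_mat M *\<^sub>v (M *\<^sub>v x) = (det M \<cdot>\<^sub>m 1\<^sub>m n) *\<^sub>v x"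
          using assoc_mult_mat_vec[OF adjM(1) M x(1)] adjM(3) by simp
        then show ?thesis
          using x(1) by (auto simp: det0 smult_mult_mat_vec[OF one_carrier_mat])
      qed
      finally have "?y \<cdot>\<^sub>v v = 0\<^sub>v n" using v by simp
      then have "?y * (C *\<^sub>v v) $ 0 = 0"
        using C_smult[OF v, of ?y] mult_mat_zero_vec[OF C] by simp
      then have y: "?y = 0" using Cv by simp
      have "?y \<cdot>\<^sub>v col B 0 = 0\<^sub>v n" using y B by (intro eq_vecI) auto
      then have "M *\<^sub>v x = 0\<^sub>v n"
        using Mx right_zero_vec[OF mult_mat_vec_carrier[OF M x(1)]] by simp
      then show ?thesis using output_nonzero_on_kernel[OF M B C adj x(1)] y by simp
    qed
    then show ?thesis using det_0_iff_vec_prod_zero[OF M'] by auto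
  qed
  define V where "V = (1 / det M') \<cdot>\<^sub>m adj_mat M'"
  have V: "V \<in> carrier_mat n n" using adj_mat(1)[OF M'] by (simp add: V_def)
  have VM: "V * M' = 1\<^sub>m n"
    unfolding V_def mult_smult_assoc_mat[OF adj_mat(1)[OF M'] M'] adj_mat(3)[OF M']
    using detM' by (intro eq_matI) auto
  have MV: "M' * V = 1\<^sub>m n" by (rule mat_mult_left_right_inverse[OF V M' VM])
  \<comment> \<open>\<open>M'\<close> maps \<open>v\<close> to \<open>t\<close> times
    \<open>col B 0\<close>, where \<open>t\<close> is \<open>det M\<close> if \<open>f = 0\<close>
    and the output of \<open>v\<close> if \<open>f = 1\<close>.\<close>
  define t where "t = det M + f * (C *\<^sub>v v) $ 0"
  have t: "t \<noteq> 0" using Cv by (auto simp: t_def f_def)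
  have "M' *\<^sub>v v = t \<cdot>\<^sub>v col B 0" using M'x[OF v] Mv by (simp add: t_def add_smult_distrib_vec)
  then have "V *\<^sub>v (M' *\<^sub>v v) = t \<cdot>\<^sub>v (V *\<^sub>v col B 0)" using mult_mat_vec[OF V cB] by simp
  moreover have "V *\<^sub>v (M' *\<^sub>v v) = v" using assoc_mult_mat_vec[OF V M' v] VM v by simp
  ultimately have "v = t \<cdot>\<^sub>v (V *\<^sub>v col B 0)" by simp
  then have "(C *\<^sub>v v) $ 0 = t * (C *\<^sub>v (V *\<^sub>v col B 0)) $ 0"
    using C_smult[OF mult_mat_vec_carrier[OF V cB]] by metis
  then have "(C *\<^sub>v (V *\<^sub>v col B 0)) $ 0 \<noteq> 0" using Cv by auto
  then show ?thesis using V VM MV unfolding M'_def by blast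
qed

section \<open>From single states to uniform nullification\<close>

lemma closed_loop_cong:
  "(\<And>i. k \<le> i \<Longrightarrow> i < k + int m \<Longrightarrow> F i = G i) \<Longrightarrow> closed_loop A b c F k x m = closed_loop A b c G k x m"
  by (induction m) auto

lemma closed_loop_add:
  "closed_loop A b c F k x (p + q) = closed_loop A b c F (k + int p) (closed_loop A b c F k x p) q"
  by (induction q) (auto simp: algebra_simps)

locale time_varying_system =
  fixes n :: nat and A b c :: "int \<Rightarrow> real mat"
  assumes A: "A k \<in> carrier_mat n n" and b: "b k \<in> carrier_mat n 1" and c: "c k \<in> carrier_mat 1 n"
begin

lemma feedback_carrier: "A k + f \<cdot>\<^sub>m (b k * c k) \<in> carrier_mat n n"
  using A[of k] b[of k] c[of k] by auto

lemma col_b: "col (b k) 0 \<in> carrier_vec n"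
  using b[of k] by auto

lemma closed_loop_carrier: "x \<in> carrier_vec n \<Longrightarrow> closed_loop A b c F k x m \<in> carrier_vec n"
  by (induction m) (simp_all add: mult_mat_vec_carrier[OF feedback_carrier])

lemma closed_loop_Suc_vec: "x \<in> carrier_vec n \<Longrightarrow> closed_loop A b c F k x (Suc m) =
    A (k + int m) *\<^sub>v closed_loop A b c F k x m +
    (F (k + int m) * (c (k + int m) *\<^sub>v closed_loop A b c F k x m) $ 0) \<cdot>\<^sub>v col (b (k + int m)) 0"
  by (simp add: feedback_mult_vec[OF A b c closed_loop_carrier])

lemma closed_loop_zero: "closed_loop A b c F k (0\<^sub>v n) m = 0\<^sub>v n"
proof (induction m)
  case (Suc m)
  then show ?case by (simp add: mult_mat_zero_vec[OF feedback_carrier])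
qed simp

lemma closed_loop_stays_zero:
  "closed_loop A b c F k x p = 0\<^sub>v n \<Longrightarrow> p \<le> q \<Longrightarrow> closed_loop A b c F k x q = 0\<^sub>v n"
  using closed_loop_add[of A b c F k x p "q - p"] closed_loop_zero by simp

lemma closed_loop_matrix:
  "\<exists>P\<in>carrier_mat n n. \<forall>x\<in>carrier_vec n. closed_loop A b c F k x m = P *\<^sub>v x"
proof (induction m)
  case 0
  show ?case by (rule bexI[of _ "1\<^sub>m n"]) auto
next
  case (Suc m)
  then obtain P where P: "P \<in> carrier_mat n n" "\<forall>x\<in>carrier_vec n. closed_loop A b c F k x m = P *\<^sub>v x" by blast
  let ?M = "A (k + int m) + F (k + int m) \<cdot>\<^sub>m (b (k + int m) * c (k + int m))"
  have M: "?M \<in> carrier_mat n n" by (rule feedback_carrier)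
  show ?case
    by (rule bexI[of _ "?M * P"]) (use P M assoc_mult_mat_vec[OF M P(1)] in auto)
qed

lemma closed_loop_zero_on_basis:
  assumes "\<And>i. i < n \<Longrightarrow> closed_loop A b c F k (unit_vec n i) m = 0\<^sub>v n" "x \<in> carrier_vec n"
  shows "closed_loop A b c F k x m = 0\<^sub>v n"
proof -
  obtain P where P: "P \<in> carrier_mat n n" "\<forall>x\<in>carrier_vec n. closed_loop A b c F k x m = P *\<^sub>v x"
    using closed_loop_matrix by blast
  have "P $$ (i, j) = 0" if "i < n" "j < n" for i j
  proof -
    have "P *\<^sub>v unit_vec n j = 0\<^sub>v n" using assms(1) P(2) that by auto
    then have "(P *\<^sub>v unit_vec n j) $ i = 0" using that by simp
    then show ?thesis using P(1) that by simp
  qed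
  then have "P = 0\<^sub>m n n" using P(1) by (intro eq_matI) auto
  then show ?thesis using P(2) assms(2) by auto
qed

text \<open>\<open>M\<close> serves all times and states. One stage of length \<open>M\<close> per
  basis vector gives a block that annihilates everything, and such blocks tile the time
  axis.\<close>

lemma uniformly_nullifiableI:
  assumes M: "\<And>k x. x \<in> carrier_vec n \<Longrightarrow> \<exists>F. closed_loop A b c F k x M = 0\<^sub>v n"
  shows "uniformly_nullifiable n A b c"
proof -
  have partial: "m \<le> n \<Longrightarrow> \<exists>F. \<forall>i<m. closed_loop A b c F k (unit_vec n i) (m * M) = 0\<^sub>v n" for k m
  proof (induction m)
    case (Suc m)
    then obtain F where F: "\<forall>i<m. closed_loop A b c F k (unit_vec n i) (m * M) = 0\<^sub>v n" by auto
    let ?x = "closed_loop A b c F k (unit_vec n m) (m * M)"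
    obtain G where G: "closed_loop A b c G (k + int (m * M)) ?x M = 0\<^sub>v n"
      using M[OF closed_loop_carrier[OF unit_vec_carrier]] by blast
    define H where "H i = (if i < k + int (m * M) then F i else G i)" for i
    have H: "closed_loop A b c H k x (Suc m * M)
        = closed_loop A b c G (k + int (m * M)) (closed_loop A b c F k x (m * M)) M" for x
    proof -
      have "closed_loop A b c H k x (Suc m * M)
        = closed_loop A b c H (k + int (m * M)) (closed_loop A b c H k x (m * M)) M"
        using closed_loop_add[of A b c H k x "m * M" M] by (simp add: add.commute)
      also have "closed_loop A b c H k x (m * M) = closed_loop A b c F k x (m * M)"
        by (rule closed_loop_cong) (simp add: H_def)
      also have "closed_loop A b c H (k + int (m * M)) (closed_loop A b c F k x (m * M)) M
        = closed_loop A b c G (k + int (m * M)) (closed_loop A b c F k x (m * M)) M"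
        by (rule closed_loop_cong) (simp add: H_def)
      finally show ?thesis .
    qed
    have "closed_loop A b c H k (unit_vec n i) (Suc m * M) = 0\<^sub>v n" if "i < Suc m" for i
      using that F G unfolding H by (cases "i = m") (auto simp: closed_loop_zero)
    then show ?case by blast
  qed simp
  \<comment> \<open>The successor keeps \<open>L\<close> positive, as division by \<open>L\<close>
    requires.\<close>
  define L where "L = Suc (n * M)"
  have "\<exists>F. \<forall>x\<in>carrier_vec n. closed_loop A b c F k x L = 0\<^sub>v n" for k
  proof -
    obtain F where "\<forall>i<n. closed_loop A b c F k (unit_vec n i) (n * M) = 0\<^sub>v n"
      using partial[of n k] by blast
    then have "\<forall>x\<in>carrier_vec n. closed_loop A b c F k x (n * M) = 0\<^sub>v n"
      using closed_loop_zero_on_basis by blast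
    then have "\<forall>x\<in>carrier_vec n. closed_loop A b c F k x L = 0\<^sub>v n"
      using closed_loop_stays_zero[of F k _ "n * M" L] by (simp add: L_def del: closed_loop.simps)
    then show ?thesis by blast
  qed
  then obtain G where G: "\<And>k x. x \<in> carrier_vec n \<Longrightarrow> closed_loop A b c (G k) k x L = 0\<^sub>v n"
    by metis
  \<comment> \<open>Each time uses the gains designed for the start of its block, the last multiple
    of \<open>L\<close> up to it.\<close>
  define F where "F i = G (i div int L * int L) i" for i
  have L: "0 < L" by (simp add: L_def)
  have block: "closed_loop A b c F (q * int L) x L = 0\<^sub>v n" if x: "x \<in> carrier_vec n" for q x
  proof -
    have "F i = G (q * int L) i" if i: "q * int L \<le> i" "i < q * int L + int L" for i
    proof -
      have "i div int L = q" using i by (intro int_div_pos_eq[where r = "i - q * int L"]) auto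
      then show ?thesis by (simp add: F_def)
    qed
    then have "closed_loop A b c F (q * int L) x L = closed_loop A b c (G (q * int L)) (q * int L) x L"
      by (intro closed_loop_cong) auto
    then show ?thesis using G[OF x] by simp
  qed
  have "closed_loop A b c F k x (2 * L) = 0\<^sub>v n" if x: "x \<in> carrier_vec n" for k x
  proof -
    \<comment> \<open>\<open>q * int L\<close> is the first block start after \<open>k\<close>, at
      most \<open>L\<close> steps away, so \<open>2 * L\<close> steps from \<open>k\<close> contain
      a full block.\<close>
    define q where "q = k div int L + 1"
    define d where "d = nat (q * int L - k)"
    have "q * int L = k - k mod int L + int L"
      by (simp add: q_def distrib_right minus_mod_eq_div_mult)
    moreover have "0 \<le> k mod int L" "k mod int L < int L" using L by auto
    ultimately have d: "k + int d = q * int L" "d \<le> L"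
      by (auto simp: d_def)
    have "closed_loop A b c F k x (d + L) = 0\<^sub>v n"
      unfolding closed_loop_add d(1) by (rule block[OF closed_loop_carrier[OF x]])
    then show ?thesis by (rule closed_loop_stays_zero) (use d(2) in simp)
  qed
  then show ?thesis unfolding uniformly_nullifiable_def by blast
qed

end

section \<open>Moving coordinates\<close>

text \<open>Vectors are padded with zeros so that they live in one type with a vector space structure.\<close>

definition vec_fun :: "real vec \<Rightarrow> nat \<Rightarrow> real" where
  "vec_fun v = (\<lambda>i. if i < dim_vec v then v $ i else 0)"

lemma vec_fun_add: "v \<in> carrier_vec n \<Longrightarrow> w \<in> carrier_vec n \<Longrightarrow> vec_fun (v + w) = vec_fun v + vec_fun w"
  by (auto simp: vec_fun_def fun_eq_iff)

lemma vec_fun_smult: "vec_fun (a \<cdot>\<^sub>v v) = (\<lambda>i. a * vec_fun v i)"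
  by (auto simp: vec_fun_def fun_eq_iff)

lemma vec_vec_fun: "v \<in> carrier_vec n \<Longrightarrow> vec n (vec_fun v) = v"
  by (intro eq_vecI) (auto simp: vec_fun_def)

lemma span_unit_fun_lessThan:
  "f \<in> fun_vs.span (unit_fun ` {..<n}) \<longleftrightarrow> (\<forall>i\<ge>n. f i = 0)" for f :: "nat \<Rightarrow> real"
proof
  show "f \<in> fun_vs.span (unit_fun ` {..<n}) \<Longrightarrow> \<forall>i\<ge>n. f i = 0"
    by (induction rule: fun_vs.span_induct_alt) (auto simp: unit_fun_def)
qed (rule in_span_unit_fun, simp_all)

section \<open>Systems under a preliminary feedback\<close>

context time_varying_system
begin

lemma smult_col_b: "a \<cdot>\<^sub>v col (b k) 0 \<in> carrier_vec n"
  using col_b by simp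

lemma zero_smult_col_b: "0 \<cdot>\<^sub>v col (b k) 0 = 0\<^sub>v n"
  using b[of k] by (intro eq_vecI) auto

lemma traj_Suc_vec: "traj A b k x u (Suc m) =
    A (k + int m) *\<^sub>v traj A b k x u m + u (k + int m) \<cdot>\<^sub>v col (b (k + int m)) 0"
  by (simp only: traj.simps mult_unit_vec1[OF b])

lemma traj_carrier: "x \<in> carrier_vec n \<Longrightarrow> traj A b k x u m \<in> carrier_vec n"
proof (induction m)
  case (Suc m)
  then show ?case
    unfolding traj_Suc_vec by (intro add_carrier_vec mult_mat_vec_carrier[OF A] smult_col_b)
qed simp

text \<open>Both systems receive the same total input at each step; this transfers controllability
  and observability.\<close>

lemma traj_feedback:
  assumes "x \<in> carrier_vec n"
    and "\<And>i. i < m \<Longrightarrow>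
      u (k + int i) = v (k + int i) + F (k + int i) * sys_output A b c k x u i"
  shows "traj (\<lambda>k. A k + F k \<cdot>\<^sub>m (b k * c k)) b k x v m = traj A b k x u m"
  using assms(2)
proof (induction m)
  case (Suc m)
  have t: "traj A b k x u m \<in> carrier_vec n" by (rule traj_carrier[OF assms(1)])
  let ?i = "k + int m" and ?x = "traj A b k x u m" and ?\<beta> = "col (b (k + int m)) 0"
  have Ax: "A ?i *\<^sub>v ?x \<in> carrier_vec n" by (rule mult_mat_vec_carrier[OF A t])
  have "traj (\<lambda>k. A k + F k \<cdot>\<^sub>m (b k * c k)) b k x v (Suc m)
    = A ?i *\<^sub>v ?x + (F ?i * (c ?i *\<^sub>v ?x) $ 0) \<cdot>\<^sub>v ?\<beta> + v ?i \<cdot>\<^sub>v ?\<beta>"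
    using Suc by (simp only: traj.simps mult_unit_vec1[OF b] feedback_mult_vec[OF A b c t])
  also have "\<dots> = A ?i *\<^sub>v ?x + (F ?i * (c ?i *\<^sub>v ?x) $ 0 + v ?i) \<cdot>\<^sub>v ?\<beta>"
    by (simp only: assoc_add_vec[OF Ax smult_col_b smult_col_b] add_smult_distrib_vec)
  also have "F ?i * (c ?i *\<^sub>v ?x) $ 0 + v ?i = u ?i"
    using Suc.prems[of m] by (simp add: sys_output_def)
  finally show ?case by (simp only: traj_Suc_vec)
qed simp

lemma closed_loop_feedback:
  "closed_loop (\<lambda>k. A k + G k \<cdot>\<^sub>m (b k * c k)) b c F k x m = closed_loop A b c (\<lambda>k. G k + F k) k x m"
proof (induction m)
  case (Suc m)
  have "A i + G i \<cdot>\<^sub>m (b i * c i) + F i \<cdot>\<^sub>m (b i * c i) = A i + (G i + F i) \<cdot>\<^sub>m (b i * c i)" for i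
    using A[of i] b[of i] c[of i] by (intro eq_matI) (auto simp: distrib_right)
  then show ?case using Suc by simp
qed simp

end

text \<open>The regularized system. By linearity, controllability is stated from the origin and
  observability as a trivial kernel of the free output.\<close>

locale invertible_system = time_varying_system +
  fixes Ai :: "int \<Rightarrow> real mat"
  assumes Ai: "Ai k \<in> carrier_mat n n" "Ai k * A k = 1\<^sub>m n" "A k * Ai k = 1\<^sub>m n"
    and c_Ai_b: "(c k *\<^sub>v (Ai k *\<^sub>v col (b k) 0)) $ 0 \<noteq> 0"
    and controllable: "\<And>k xf. xf \<in> carrier_vec n \<Longrightarrow> \<exists>u. traj A b k (0\<^sub>v n) u n = xf"
    and observable: "\<And>k x. x \<in> carrier_vec n \<Longrightarrow>
      (\<And>j. j < n \<Longrightarrow> (c (k + int j) *\<^sub>v traj A b k x (\<lambda>_. 0) j) $ 0 = 0) \<Longrightarrow> x = 0\<^sub>v n"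
begin

text \<open>The free transition matrix from time \<open>k\<close> to \<open>k + j\<close>;
  \<open>Psi\<close> below is its inverse.\<close>

primrec Phi :: "int \<Rightarrow> nat \<Rightarrow> real mat" where
  "Phi k 0 = 1\<^sub>m n"
| "Phi k (Suc j) = A (k + int j) * Phi k j"

primrec Psi :: "int \<Rightarrow> nat \<Rightarrow> real mat" where
  "Psi k 0 = 1\<^sub>m n"
| "Psi k (Suc j) = Psi k j * Ai (k + int j)"

lemma Phi: "Phi k j \<in> carrier_mat n n"
  by (induction j) (auto intro: mult_carrier_mat[OF A])

lemma Psi: "Psi k j \<in> carrier_mat n n"
  by (induction j) (auto intro: mult_carrier_mat[OF _ Ai(1)])

lemma Psi_Suc_A:
  assumes "x \<in> carrier_vec n"
  shows "Psi k (Suc j) *\<^sub>v (A (k + int j) *\<^sub>v x) = Psi k j *\<^sub>v x"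
proof -
  have "Psi k (Suc j) *\<^sub>v (A (k + int j) *\<^sub>v x) = Psi k j *\<^sub>v (Ai (k + int j) *\<^sub>v (A (k + int j) *\<^sub>v x))"
    using assoc_mult_mat_vec[OF Psi Ai(1) mult_mat_vec_carrier[OF A assms]] by simp
  also have "Ai (k + int j) *\<^sub>v (A (k + int j) *\<^sub>v x) = x"
    using assoc_mult_mat_vec[OF Ai(1) A assms, symmetric] Ai(2) assms by simp
  finally show ?thesis .
qed

lemma Psi_Phi: "x \<in> carrier_vec n \<Longrightarrow> Psi k j *\<^sub>v (Phi k j *\<^sub>v x) = x"
proof (induction j)
  case (Suc j)
  have "Phi k (Suc j) *\<^sub>v x = A (k + int j) *\<^sub>v (Phi k j *\<^sub>v x)"
    using assoc_mult_mat_vec[OF A Phi Suc.prems] by simp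
  then show ?case
    using Psi_Suc_A[OF mult_mat_vec_carrier[OF Phi Suc.prems]] Suc by simp
qed simp

lemma Phi_Psi: "x \<in> carrier_vec n \<Longrightarrow> Phi k j *\<^sub>v (Psi k j *\<^sub>v x) = x"
proof -
  assume x: "x \<in> carrier_vec n"
  have "Psi k j * Phi k j = 1\<^sub>m n"
  proof (induction j)
    case (Suc j)
    have "Psi k (Suc j) * Phi k (Suc j) = Psi k j * (Ai (k + int j) * (A (k + int j) * Phi k j))"
      using assoc_mult_mat[OF Psi Ai(1) mult_carrier_mat[OF A Phi]] by simp
    also have "Ai (k + int j) * (A (k + int j) * Phi k j) = Phi k j"
      using assoc_mult_mat[OF Ai(1) A Phi, symmetric] Ai(2) left_mult_one_mat[OF Phi] by simp
    finally show ?case using Suc by simp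
  qed simp
  then have "Phi k j * Psi k j = 1\<^sub>m n" by (rule mat_mult_left_right_inverse[OF Psi Phi])
  then show ?thesis using assoc_mult_mat_vec[OF Phi Psi x, symmetric] x by simp
qed

text \<open>In the coordinates \<open>z\<^sub>j = Psi k j x\<^sub>j\<close> the drift becomes the identity; \<open>moving_b\<close> and \<open>moving_c\<close> are the
  input vectors and output functionals there.\<close>

definition moving_b :: "int \<Rightarrow> nat \<Rightarrow> nat \<Rightarrow> real" where
  "moving_b k j = vec_fun (Psi k (Suc j) *\<^sub>v col (b (k + int j)) 0)"

definition moving_c :: "int \<Rightarrow> nat \<Rightarrow> (nat \<Rightarrow> real) \<Rightarrow> real" where
  "moving_c k j f = (c (k + int j) *\<^sub>v (Phi k j *\<^sub>v vec n f)) $ 0"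

section \<open>Trajectories in moving coordinates\<close>

lemma vec_fun_in_span: "v \<in> carrier_vec n \<Longrightarrow> vec_fun v \<in> fun_vs.span (unit_fun ` {..<n})"
  by (auto simp: span_unit_fun_lessThan vec_fun_def)

lemma moving_c_vec_fun: "x \<in> carrier_vec n \<Longrightarrow> moving_c k j (vec_fun (Psi k j *\<^sub>v x)) = (c (k + int j) *\<^sub>v x) $ 0"
  unfolding moving_c_def by (simp only: vec_vec_fun[OF mult_mat_vec_carrier[OF Psi]] Phi_Psi)

text \<open>\<open>Psi k (Suc j)\<close> undoes \<open>A (k + int j)\<close>, so the drift
  disappears. The input shows in the state one step later, hence \<open>Suc j\<close> in
  \<open>moving_b\<close>.\<close>

lemma vec_fun_step:
  assumes "x \<in> carrier_vec n"
  shows "vec_fun (Psi k (Suc j) *\<^sub>v (A (k + int j) *\<^sub>v x + a \<cdot>\<^sub>v col (b (k + int j)) 0))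
    = vec_fun (Psi k j *\<^sub>v x) + (\<lambda>i. a * moving_b k j i)"
proof -
  have Ax: "A (k + int j) *\<^sub>v x \<in> carrier_vec n" by (rule mult_mat_vec_carrier[OF A assms])
  have "Psi k (Suc j) *\<^sub>v (A (k + int j) *\<^sub>v x + a \<cdot>\<^sub>v col (b (k + int j)) 0)
    = Psi k j *\<^sub>v x + a \<cdot>\<^sub>v (Psi k (Suc j) *\<^sub>v col (b (k + int j)) 0)"
    by (simp only: mult_add_distrib_mat_vec[OF Psi Ax smult_col_b]
      mult_mat_vec[OF Psi col_b] Psi_Suc_A[OF assms])
  then show ?thesis unfolding moving_b_def
    by (simp only: vec_fun_smult
      vec_fun_add[OF mult_mat_vec_carrier[OF Psi assms] smult_carrier_vec[THEN iffD2, OF mult_mat_vec_carrier[OF Psi col_b]]])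
qed

text \<open>From the origin the moving coordinate only accumulates input terms; with controllability
  this gives \<open>b_spans\<close>.\<close>

lemma traj_in_span:
  "vec_fun (Psi k (s + m) *\<^sub>v traj A b (k + int s) (0\<^sub>v n) u m) \<in> fun_vs.span (moving_b k ` {s..<s+m})"
proof (induction m)
  case 0
  have "vec_fun (0\<^sub>v n :: real vec) = 0" by (auto simp: vec_fun_def fun_eq_iff)
  then show ?case by (simp add: mult_mat_zero_vec[OF Psi] fun_vs.span_zero[unfolded zero_fun_def] zero_fun_def)
next
  case (Suc m)
  let ?x = "traj A b (k + int s) (0\<^sub>v n) u m"
  have k: "k + int s + int m = k + int (s + m)" by simp
  have eq: "vec_fun (Psi k (s + Suc m) *\<^sub>v traj A b (k + int s) (0\<^sub>v n) u (Suc m))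
     = vec_fun (Psi k (s + m) *\<^sub>v ?x) + (\<lambda>i. u (k + int (s + m)) * moving_b k (s + m) i)"
    unfolding traj_Suc_vec k add_Suc_right
    by (rule vec_fun_step[OF traj_carrier]) simp
  have "fun_vs.span (moving_b k ` {s..<s+m}) \<subseteq> fun_vs.span (moving_b k ` {s..<s+Suc m})"
    by (intro fun_vs.span_mono image_mono) auto
  then have "vec_fun (Psi k (s + m) *\<^sub>v ?x) \<in> fun_vs.span (moving_b k ` {s..<s+Suc m})"
    using Suc by blast
  then show ?case unfolding eq
    by (intro fun_vs.span_add fun_vs.span_scale) (auto intro: fun_vs.span_base)
qed

text \<open>The moving coordinate is constantly \<open>x\<close>; with observability this gives
  \<open>c_separates\<close>.\<close>

lemma free_traj:
  "x \<in> carrier_vec n \<Longrightarrow>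
    traj A b (k + int s) (Phi k s *\<^sub>v x) (\<lambda>_. 0) m = Phi k (s + m) *\<^sub>v x"
proof (induction m)
  case (Suc m)
  have k: "k + int s + int m = k + int (s + m)" by simp
  have "traj A b (k + int s) (Phi k s *\<^sub>v x) (\<lambda>_. 0) (Suc m)
    = A (k + int (s + m)) *\<^sub>v (Phi k (s + m) *\<^sub>v x) + 0 \<cdot>\<^sub>v col (b (k + int (s + m))) 0"
    unfolding traj_Suc_vec k Suc.IH[OF Suc.prems] ..
  also have "\<dots> = A (k + int (s + m)) *\<^sub>v (Phi k (s + m) *\<^sub>v x)"
    using mult_mat_vec_carrier[OF A mult_mat_vec_carrier[OF Phi Suc.prems]] col_b
    by (metis right_zero_vec zero_smult_col_b)
  also have "\<dots> = Phi k (s + Suc m) *\<^sub>v x"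
    using assoc_mult_mat_vec[OF A Phi Suc.prems] by simp
  finally show ?case .
qed simp

lemma rank_one_system:
  "rank_one_system (\<lambda>a f i. a * f i) n (unit_fun ` {..<n}) (moving_b k) (moving_c k)"
proof -
  interpret vector_space_real "\<lambda>a (f :: nat \<Rightarrow> real) i. a * f i" by unfold_locales
  show ?thesis
  proof
    show "finite (unit_fun ` {..<n} :: (nat \<Rightarrow> real) set)" by simp
    show "card (unit_fun ` {..<n} :: (nat \<Rightarrow> real) set) = n"
      by (subst card_image[OF inj_on_subset[OF inj_unit_fun subset_UNIV]]) simp
    show "\<not> fun_vs.dependent (unit_fun ` {..<n} :: (nat \<Rightarrow> real) set)"
      by (rule independent_unit_fun) simp
    show "moving_b k j \<in> fun_vs.span (unit_fun ` {..<n})" for j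
      unfolding moving_b_def by (rule vec_fun_in_span[OF mult_mat_vec_carrier[OF Psi col_b]])
    show "functional (moving_c k j)" for j
    proof -
      have lin: "(c i *\<^sub>v (M *\<^sub>v (x + y))) $ 0 = (c i *\<^sub>v (M *\<^sub>v x)) $ 0 + (c i *\<^sub>v (M *\<^sub>v y)) $ 0"
        and scl: "(c i *\<^sub>v (M *\<^sub>v (a \<cdot>\<^sub>v x))) $ 0 = a * (c i *\<^sub>v (M *\<^sub>v x)) $ 0"
        if "M \<in> carrier_mat n n" "x \<in> carrier_vec n" "y \<in> carrier_vec n" for i M x y a
        using that c[of i]
        by (auto simp: mult_add_distrib_mat_vec[of _ n n] mult_mat_vec[of _ n n]
          mult_add_distrib_mat_vec[of _ 1 n] mult_mat_vec[of _ 1 n] simp del: index_mult_mat_vec)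
      have v: "vec n (f + g) = vec n f + vec n g" "vec n (\<lambda>i. a * f i) = a \<cdot>\<^sub>v vec n f" for f g :: "nat \<Rightarrow> real" and a
        by auto
      show ?thesis
        unfolding functional_def moving_c_def v by (auto simp: lin[OF Phi] scl[OF Phi _ zero_carrier_vec] simp del: index_mult_mat_vec)
    qed
    show "unit_fun ` {..<n} \<subseteq> fun_vs.span (moving_b k ` {s..<s+n})" for s
    proof
      fix f :: "nat \<Rightarrow> real" assume "f \<in> unit_fun ` {..<n}"
      then have f: "vec_fun (vec n f) = f" by (auto simp: vec_fun_def unit_fun_def fun_eq_iff)
      obtain u where "traj A b (k + int s) (0\<^sub>v n) u n = Phi k (s + n) *\<^sub>v vec n f"
        using controllable[OF mult_mat_vec_carrier[OF Phi vec_carrier]] by blast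
      then have "vec_fun (Psi k (s + n) *\<^sub>v (Phi k (s + n) *\<^sub>v vec n f)) \<in> fun_vs.span (moving_b k ` {s..<s+n})"
        using traj_in_span[of k s n u] by simp
      then show "f \<in> fun_vs.span (moving_b k ` {s..<s+n})" by (simp add: Psi_Phi f)
    qed
    show "z = 0" if z: "z \<in> fun_vs.span (unit_fun ` {..<n})"
      and sep: "\<And>i. i \<in> {s..<s+n} \<Longrightarrow> moving_c k i z = 0" for z s
    proof -
      have "Phi k s *\<^sub>v vec n z = 0\<^sub>v n"
      proof (rule observable[where k = "k + int s"])
        fix j assume "j < n"
        then have "moving_c k (s + j) z = 0" using sep by simp
        then show "(c (k + int s + int j) *\<^sub>v traj A b (k + int s) (Phi k s *\<^sub>v vec n z) (\<lambda>_. 0) j) $ 0 = 0"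
          unfolding free_traj[OF vec_carrier] moving_c_def by (simp add: add.assoc)
      qed (rule mult_mat_vec_carrier[OF Phi vec_carrier])
      then have "vec n z = 0\<^sub>v n"
        using Psi_Phi[OF vec_carrier, of k s z] mult_mat_zero_vec[OF Psi] by simp
      then have "z i = 0" if "i < n" for i using that by (metis index_vec index_zero_vec(1))
      then have "z i = 0" for i using z by (cases "i < n") (auto simp: span_unit_fun_lessThan)
      then show ?thesis by (auto simp: fun_eq_iff)
    qed
    show "moving_c k j (moving_b k j) \<noteq> 0" for j
    proof -
      have "moving_b k j = vec_fun (Psi k j *\<^sub>v (Ai (k + int j) *\<^sub>v col (b (k + int j)) 0))"
        unfolding moving_b_def using assoc_mult_mat_vec[OF Psi Ai(1) col_b] by simp
      then show ?thesis
        using moving_c_vec_fun[OF mult_mat_vec_carrier[OF Ai(1) col_b]] c_Ai_b by metis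
    qed
  qed
qed

lemma vector_nullifiable:
  assumes x: "x \<in> carrier_vec n"
  shows "\<exists>F. closed_loop A b c F k x (n * n) = 0\<^sub>v n"
proof -
  interpret S: rank_one_system "\<lambda>a f i. a * f i" n "unit_fun ` {..<n}" "moving_b k" "moving_c k"
    by (rule rank_one_system)
  obtain F where F: "S.orbit F (vec_fun x) (n * n) = 0"
    using S.orbit_nullifiable[OF vec_fun_in_span[OF x]] by blast
  \<comment> \<open>\<open>orbit\<close> counts steps from 0, while the closed loop starts at time
    \<open>k\<close>.\<close>
  define G where "G i = F (nat (i - k))" for i
  let ?x = "closed_loop A b c G k x"
  have xc: "?x m \<in> carrier_vec n" for m by (rule closed_loop_carrier[OF x])
  have "vec_fun (Psi k m *\<^sub>v ?x m) = S.orbit F (vec_fun x) m" for m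
  proof (induction m)
    case 0
    show ?case using x by simp
  next
    case (Suc m)
    show ?case
      unfolding closed_loop_Suc_vec[OF x] vec_fun_step[OF xc] S.orbit.simps Suc[symmetric]
        moving_c_vec_fun[OF xc] by (simp add: G_def)
  qed
  then have "vec_fun (Psi k (n * n) *\<^sub>v ?x (n * n)) = 0" using F by simp
  then have "Psi k (n * n) *\<^sub>v ?x (n * n) = vec n 0"
    using vec_vec_fun[OF mult_mat_vec_carrier[OF Psi xc]] by metis
  also have "vec n 0 = (0\<^sub>v n :: real vec)" by auto
  finally have "?x (n * n) = 0\<^sub>v n"
    using Phi_Psi[OF xc, of k "n * n" "n * n"] by (simp add: mult_mat_zero_vec[OF Phi])
  then show ?thesis by blast
qed

end

theorem theorem1:
  fixes n :: nat and A b c :: "int \<Rightarrow> real mat"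
  assumes "n \<ge> 1"
    and "\<And>k. A k \<in> carrier_mat n n"
    and "\<And>k. b k \<in> carrier_mat n 1"
    and "\<And>k. c k \<in> carrier_mat 1 n"
    and "completely_controllable n A b"
    and "completely_observable n A b c"
    and "\<And>k. (c k * adj_mat (A k) * b k) $$ (0, 0) \<noteq> 0"
  shows "uniformly_nullifiable n A b c"
proof -
  interpret S: time_varying_system n A b c by unfold_locales (use assms in auto)
  have "\<forall>k. \<exists>f V. V \<in> carrier_mat n n \<and> V * (A k + f \<cdot>\<^sub>m (b k * c k)) = 1\<^sub>m n \<and>
    (A k + f \<cdot>\<^sub>m (b k * c k)) * V = 1\<^sub>m n \<and> (c k *\<^sub>v (V *\<^sub>v col (b k) 0)) $ 0 \<noteq> 0"
    using regularizing_feedback assms by blast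
  then obtain G V where V: "\<And>k. V k \<in> carrier_mat n n"
      "\<And>k. V k * (A k + G k \<cdot>\<^sub>m (b k * c k)) = 1\<^sub>m n"
      "\<And>k. (A k + G k \<cdot>\<^sub>m (b k * c k)) * V k = 1\<^sub>m n"
      "\<And>k. (c k *\<^sub>v (V k *\<^sub>v col (b k) 0)) $ 0 \<noteq> 0"
    by metis
  let ?A = "\<lambda>k. A k + G k \<cdot>\<^sub>m (b k * c k)"
  interpret T: invertible_system n ?A b c V
  proof
    show "\<exists>u. traj ?A b k (0\<^sub>v n) u n = xf" if xf: "xf \<in> carrier_vec n" for k xf
    proof -
      obtain u where u: "traj A b k (0\<^sub>v n) u n = xf"
        using assms(5) xf unfolding completely_controllable_def by (meson zero_carrier_vec)
      \<comment> \<open>Subtracting the preliminary feedback along the old trajectory restores the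
        total input \<open>u\<close>; \<open>nat (i - k)\<close> is the step at time
        \<open>i\<close>.\<close>
      let ?v = "\<lambda>i. u i - G i * sys_output A b c k (0\<^sub>v n) u (nat (i - k))"
      have "traj ?A b k (0\<^sub>v n) ?v n = traj A b k (0\<^sub>v n) u n"
        by (rule S.traj_feedback) auto
      then show ?thesis using u by blast
    qed
    show "x = 0\<^sub>v n" if x: "x \<in> carrier_vec n"
      and y: "\<And>j. j < n \<Longrightarrow> (c (k + int j) *\<^sub>v traj ?A b k x (\<lambda>_. 0) j) $ 0 = 0" for k x
    proof -
      \<comment> \<open>Strong induction: zero outputs so far mean that the feedback added nothing,
        so both free trajectories still agree at step \<open>j\<close>.\<close>
      have out: "sys_output A b c k x (\<lambda>_. 0) j = 0" if "j < n" for j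
        using that
      proof (induction j rule: less_induct)
        case (less j)
        have "traj ?A b k x (\<lambda>_. 0) j = traj A b k x (\<lambda>_. 0) j"
          by (rule S.traj_feedback[OF x]) (use less in auto)
        then show ?case using y[OF less.prems] by (simp add: sys_output_def)
      qed
      have t0: "traj A b k (0\<^sub>v n) (\<lambda>_. 0) j = 0\<^sub>v n" for j
      proof (induction j)
        case (Suc j)
        then show ?case
          by (simp only: S.traj_Suc_vec mult_mat_zero_vec[OF S.A] S.zero_smult_col_b) simp
      qed simp
      have "sys_output A b c k (0\<^sub>v n) (\<lambda>_. 0) j = 0" for j
        by (simp only: sys_output_def t0 mult_mat_zero_vec[OF S.c]) simp
      then show ?thesis
        using assms(6) x out unfolding completely_observable_def by (metis zero_carrier_vec)
    qed
  qed (use V S.feedback_carrier S.b S.c in auto)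
  have "uniformly_nullifiable n ?A b c"
    by (rule T.uniformly_nullifiableI[OF T.vector_nullifiable])
  then show ?thesis
    unfolding uniformly_nullifiable_def S.closed_loop_feedback by metis
qed

end
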